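(* Assume that the map $h\mapsto J''(\bar x)h^2$ is weak-$\star$ lower semicontinuous, that $J'(\bar x)\in-\mathcal N_C^\star(\bar x)$ and that $$Q_C^{\bar x,J'(\bar x)}(h)+J''(\bar x)h^2>0\qquad\forall h\in\mathcal K_C^\star(\bar x,J'(\bar x))\setminus\{0\}.$$ Suppose further that the following non-degeneracy condition (NDC) holds: for all $\{h_k\}\subset X$, $\{t_k\}\subset\mathbb R^+$ with $\bar x+t_kh_k\in C$, $h_k\stackrel{\star}{\rightharpoonup}0$, $t_k\searrow0$ and $\|h_k\|_X=1$, it is true that $$\liminf_{k\to\infty}\Big(\langle J'(\bar x),h_k/t_k\rangle+\frac12J''(\bar x)h_k^2\Big)>0.$$ Then there exist constants $c>0$ and $\varepsilon>0$ such that $$J(x)\ge J(\bar x)+\frac c2\|x-\bar x\|_X^2\qquad\forall x\in C\cap B_\varepsilon^X(\bar x).$$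
   Context: Standing assumptions: $X$ is the topological dual of a separable Banach space $Y$; $\iota:Y\to X^\star$ is the canonical embedding; $C\subset X$ is closed and non-empty; $\bar x\in C$ is fixed; $B_\varepsilon^X(\bar x)$ is the closed ball of radius $\varepsilon$ around $\bar x$. The function $J:C\to\mathbb R$ is such that there exist $J'(\bar x)\in\iota(Y)$ and a bounded bilinear form $J''(\bar x):X\times X\to\mathbb R$ with $$\lim_{k\to\infty}\frac{J(\bar x+t_kh_k)-J(\bar x)-t_kJ'(\bar x)h_k-\frac12t_k^2J''(\bar x)h_k^2}{t_k^2}=0$$ for all $\{h_k\}\subset X$, $\{t_k\}\subset\mathbb R^+$ with $t_k\searrow0$, $h_k\stackrel{\star}{\rightharpoonup}h\in X$ (weak-$\star$ convergence) and $\bar x+t_kh_k\in C$. Here $J'(\bar x)h:=\langle J'(\bar x),h\rangle$ and $J''(\bar x)h^2:=J''(\bar x)(h,h)$. For $x\in C$: the weak-$\star$ outer tangent cone is $\mathcal T_C^\star(x):=\{h\in X\mid\exists t_k\searrow0,\ \exists x_k\in C:\ (x_k-x)/t_k\stackrel{\star}{\rightharpoonup}h\}$; the weak-$\star$ normal cone is $\mathcal N_C^\star(x):=\{x^\star\in\iota(Y)\mid\langle x^\star,h\rangle\le0\ \forall h\in\mathcal T_C^\star(x)\}$; for $\varphi\in-\mathcal N_C^\star(x)$ the critical cone is $\mathcal K_C^\star(x,\varphi):=\mathcal T_C^\star(x)\cap\varphi^\perp$, where $\varphi^\perp=\{h\in X\mid\langle\varphi,h\rangle=0\}$. Directional curvature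 functional: for $x\in C$, $\varphi\in-\mathcal N_C^\star(x)$, define $Q_C^{x,\varphi}:\mathcal K_C^\star(x,\varphi)\to[-\infty,\infty]$ by $$Q_C^{x,\varphi}(h):=\inf\Big\{\liminf_{k\to\infty}\langle\varphi,r_k\rangle\ \Big|\ \{r_k\}\subset X,\{t_k\}\subset\mathbb R^+:\ t_k\searrow0,\ t_kr_k\stackrel{\star}{\rightharpoonup}0,\ x+t_kh+\tfrac12t_k^2r_k\in C\Big\}.$$ *)

theory Defs
  imports "HOL-Analysis.Analysis"
begin

text \<open>
  The space \<open>X\<close> is the normed dual \<open>'y dual\<close> of \<open>Y = 'y\<close>.
\<close>

type_synonym 'y dual = "'y \<Rightarrow>\<^sub>L real"

text \<open>
  For scalar-valued operators, the strong operator topology (pointwise convergence on \<open>Y\<close>) is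
  the weak-star topology.
\<close>

abbreviation weak_star_topology :: "('y::real_normed_vector) dual topology" where
  "weak_star_topology \<equiv> strong_operator_topology"

definition weak_star_tendsto :: "(nat \<Rightarrow> ('y::real_normed_vector) dual) \<Rightarrow> 'y dual \<Rightarrow> bool" where
  "weak_star_tendsto h l \<longleftrightarrow> limitin weak_star_topology h l sequentially"

lemma weak_star_tendsto_iff:
  "weak_star_tendsto h l \<longleftrightarrow> (\<forall>y. (\<lambda>k. blinfun_apply (h k) y) \<longlonglongrightarrow> blinfun_apply l y)"
proof
  assume "weak_star_tendsto h l"
  then have lim: "limitin strong_operator_topology h l sequentially"
    by (simp add: weak_star_tendsto_def)
  show "\<forall>y. (\<lambda>k. blinfun_apply (h k) y) \<longlonglongrightarrow> blinfun_apply l y"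
    using continuous_map_limit[OF strong_operator_topology_continuous_evaluation lim]
    by (simp add: o_def)
next
  assume pointwise: "\<forall>y. (\<lambda>k. blinfun_apply (h k) y) \<longlonglongrightarrow> blinfun_apply l y"
  have lim: "(\<lambda>k. blinfun_apply (h k)) \<longlonglongrightarrow> blinfun_apply l"
    using pointwise
    by (simp flip: limitin_canonical_iff euclidean_product_topology
        add: limitin_componentwise)
  have "\<forall>\<^sub>F k in sequentially. h k \<in> U"
    if U: "openin strong_operator_topology U" "l \<in> U" for U
  proof -
    obtain V where V: "open V" "U = blinfun_apply -` V"
      using U(1) by (auto simp: strong_operator_topology_def openin_pullback_topology)
    then show ?thesis
      using topological_tendstoD[OF lim, of V] U(2) by auto
  qed
  then show "weak_star_tendsto h l"
    by (auto simp: weak_star_tendsto_def limitin_def strong_operator_topology_topspace)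
qed

definition lower_semicontinuous_map :: "'a topology \<Rightarrow> ('a \<Rightarrow> real) \<Rightarrow> bool" where
  "lower_semicontinuous_map T f \<longleftrightarrow> (\<forall>a. openin T {x \<in> topspace T. a < f x})"

definition canonical_embedding :: "('y::real_normed_vector) \<Rightarrow> 'y dual dual" where
  "canonical_embedding y = Blinfun (\<lambda>h. blinfun_apply h y)"

lemma canonical_embedding_apply [simp]:
  "blinfun_apply (canonical_embedding y) h = blinfun_apply h y"
  by (simp add: canonical_embedding_def bounded_linear_Blinfun_apply
      blinfun.bounded_linear_left)

definition decreases_to_zero :: "(nat \<Rightarrow> real) \<Rightarrow> bool" where
  "decreases_to_zero t \<longleftrightarrow> (\<forall>k. 0 < t k) \<and> decseq t \<and> t \<longlonglongrightarrow> 0"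

definition weak_star_tangent_cone ::
    "('y::real_normed_vector) dual set \<Rightarrow> 'y dual \<Rightarrow> 'y dual set" where
  "weak_star_tangent_cone C x =
     {h. \<exists>t xs. decreases_to_zero t \<and> (\<forall>k. xs k \<in> C) \<and>
          weak_star_tendsto (\<lambda>k. (xs k - x) /\<^sub>R t k) h}"

text \<open>Only functionals represented by an element of \<open>Y\<close> belong to the normal cone.\<close>

definition weak_star_normal_cone ::
    "('y::real_normed_vector) dual set \<Rightarrow> 'y dual \<Rightarrow> 'y dual dual set" where
  "weak_star_normal_cone C x =
     {\<phi> \<in> range canonical_embedding. \<forall>h \<in> weak_star_tangent_cone C x. blinfun_apply \<phi> h \<le> 0}"

definition critical_cone ::
    "('y::real_normed_vector) dual set \<Rightarrow> 'y dual \<Rightarrow> 'y dual dual \<Rightarrow> 'y dual set" where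
  "critical_cone C x \<phi> = weak_star_tangent_cone C x \<inter> {h. blinfun_apply \<phi> h = 0}"

text \<open>
  The directional curvature functional; the infimum over the empty set is \<open>\<infinity>\<close>.
  It is meaningful for \<open>x \<in> C\<close>, \<open>\<phi> \<in> - weak_star_normal_cone C x\<close> and
  \<open>h \<in> critical_cone C x \<phi>\<close>.
\<close>

definition curvature_functional ::
    "('y::real_normed_vector) dual set \<Rightarrow> 'y dual \<Rightarrow> 'y dual dual \<Rightarrow> 'y dual \<Rightarrow> ereal" where
  "curvature_functional C x \<phi> h =
     Inf {liminf (\<lambda>k. ereal (blinfun_apply \<phi> (r k))) | r t.
            decreases_to_zero t \<and> weak_star_tendsto (\<lambda>k. t k *\<^sub>R r k) 0 \<and>
            (\<forall>k. x + t k *\<^sub>R h + ((1/2) * (t k)\<^sup>2) *\<^sub>R r k \<in> C)}"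

definition second_order_expansion ::
    "('y::real_normed_vector) dual set \<Rightarrow> ('y dual \<Rightarrow> real) \<Rightarrow> 'y dual \<Rightarrow>
     'y dual dual \<Rightarrow> ('y dual \<Rightarrow> 'y dual \<Rightarrow> real) \<Rightarrow> bool" where
  "second_order_expansion C J x J' J'' \<longleftrightarrow>
     J' \<in> range canonical_embedding \<and> bounded_bilinear J'' \<and>
     (\<forall>h l t. decreases_to_zero t \<longrightarrow> weak_star_tendsto h l \<longrightarrow>
        (\<forall>k. x + t k *\<^sub>R h k \<in> C) \<longrightarrow>
        (\<lambda>k. (J (x + t k *\<^sub>R h k) - J x - t k * blinfun_apply J' (h k)
               - (1/2) * (t k)\<^sup>2 * J'' (h k) (h k)) / (t k)\<^sup>2) \<longlonglongrightarrow> 0)"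

definition nondegeneracy_condition ::
    "('y::real_normed_vector) dual set \<Rightarrow> 'y dual \<Rightarrow>
     'y dual dual \<Rightarrow> ('y dual \<Rightarrow> 'y dual \<Rightarrow> real) \<Rightarrow> bool" where
  "nondegeneracy_condition C x J' J'' \<longleftrightarrow>
     (\<forall>h t. (\<forall>k. x + t k *\<^sub>R h k \<in> C) \<longrightarrow> weak_star_tendsto h 0 \<longrightarrow>
        decreases_to_zero t \<longrightarrow> (\<forall>k. norm (h k) = 1) \<longrightarrow>
        liminf (\<lambda>k. ereal (blinfun_apply J' (h k /\<^sub>R t k) + (1/2) * J'' (h k) (h k))) > 0)"

end

theory Submission
  imports Defs
begin

text \<open>
  The argument is by contradiction and compactness. If quadratic growth fails for every constant and
  every radius, there are points \<open>x k = xbar + t k *\<^sub>R h k\<close> of \<open>C\<close> with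
  \<open>norm (h k) = 1\<close>, \<open>t k\<close> decreasing to zero and
  \<open>J (x k) - J xbar \<le> d k * (t k)\<^sup>2\<close> for some \<open>d\<close> tending to zero. Since
  the predual is separable, a subsequence of the directions \<open>h k\<close> has a weak-star limit \<open>h\<close>
  (lemma \<open>bounded_imp_weak_star_convergent_subsequence\<close>), and dividing the second-order expansion by
  \<open>(t k)\<^sup>2\<close> shows that
  \<open>J' (h k) / t k + 1/2 * J'' (h k) (h k)\<close> is bounded above by a null sequence.

  If \<open>h = 0\<close>, this contradicts the non-degeneracy condition. If \<open>h \<noteq> 0\<close>, multiplying the bound by
  \<open>t k\<close> gives \<open>J' h \<le> 0\<close> in the limit, because \<open>J''\<close> is bounded on unit vectors and \<open>J'\<close>, being
  represented by an element of the predual, is weak-star continuous; as \<open>- J'\<close> lies in the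
  normal cone, \<open>h\<close> is critical. The second-order corrections
  \<open>r k = 2 *\<^sub>R (h k - h) /\<^sub>R t k\<close>
  then compete in the infimum that defines the curvature functional, and weak-star lower semicontinuity of the
  quadratic form yields \<open>Q h \<le> - J'' h h\<close> (lemma
  \<open>curvature_functional_le\<close>), contradicting the second-order condition.
\<close>

section \<open>Sequential weak-star compactness\<close>

text \<open>The uniform bound passes to the pointwise limit, so that the limit is again a bounded functional.\<close>

lemma bounded_pointwise_convergent_imp_weak_star:
  fixes f :: "nat \<Rightarrow> ('y::real_normed_vector) dual"
  assumes bound: "\<And>k. norm (f k) \<le> B"
    and conv: "\<And>y. convergent (\<lambda>k. blinfun_apply (f k) y)"
  obtains l where "weak_star_tendsto f l"
proof -
  define g where "g y = lim (\<lambda>k. blinfun_apply (f k) y)" for y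
  have lim: "(\<lambda>k. blinfun_apply (f k) y) \<longlonglongrightarrow> g y" for y
    using conv by (simp add: g_def convergent_LIMSEQ_iff)
  have "bounded_linear g"
  proof (rule bounded_linear_intro)
    show "g (x + y) = g x + g y" for x y
      using tendsto_add[OF lim[of x] lim[of y]] lim[of "x + y"]
      by (auto simp: blinfun.add_right intro: LIMSEQ_unique)
    show "g (c *\<^sub>R x) = c *\<^sub>R g x" for c x
      using tendsto_scaleR[OF tendsto_const lim[of x], of c] lim[of "c *\<^sub>R x"]
      by (auto simp: blinfun.scaleR_right intro: LIMSEQ_unique)
    have "norm (blinfun_apply (f k) x) \<le> norm x * B" for k x
      by (rule order_trans[OF norm_blinfun])
        (use mult_right_mono[OF bound norm_ge_zero] in \<open>simp add: mult.commute\<close>)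
    then show "norm (g x) \<le> norm x * B" for x
      using tendsto_norm[OF lim[of x]] by (intro LIMSEQ_le_const2) auto
  qed
  then have "weak_star_tendsto f (Blinfun g)"
    using lim by (simp add: weak_star_tendsto_iff bounded_linear_Blinfun_apply)
  then show thesis ..
qed

text \<open>
  A bounded sequence of functionals is equicontinuous, hence convergence on a dense set
  propagates to the whole space.
\<close>

lemma bounded_convergent_on_dense_imp_convergent:
  fixes f :: "nat \<Rightarrow> ('y::real_normed_vector) dual"
  assumes bound: "\<And>k. norm (f k) \<le> B"
    and dense: "closure D = UNIV"
    and conv: "\<And>d. d \<in> D \<Longrightarrow> convergent (\<lambda>k. blinfun_apply (f k) d)"
  shows "convergent (\<lambda>k. blinfun_apply (f k) y)"
proof -
  have "Cauchy (\<lambda>k. blinfun_apply (f k) y)"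
  proof (rule metric_CauchyI)
    fix e :: real assume "e > 0"
    have B: "B \<ge> 0"
      using bound[of 0] norm_ge_zero order_trans by blast
    \<comment> \<open>Adding one keeps the divisor positive when the bound is zero.\<close>
    have "e / (3 * (B + 1)) > 0"
      using \<open>e > 0\<close> B by simp
    moreover have "y \<in> closure D"
      using dense by simp
    ultimately obtain d where d: "d \<in> D" "dist d y < e / (3 * (B + 1))"
      unfolding closure_approachable by blast
    have near: "\<bar>blinfun_apply (f k) y - blinfun_apply (f k) d\<bar> < e / 3" for k
    proof -
      have "\<bar>blinfun_apply (f k) y - blinfun_apply (f k) d\<bar> \<le> norm (f k) * norm (y - d)"
        using norm_blinfun[of "f k" "y - d"] by (simp add: blinfun.diff_right)
      also have "\<dots> \<le> (B + 1) * norm (y - d)"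
        using bound[of k] by (intro mult_right_mono) auto
      also have "\<dots> < (B + 1) * (e / (3 * (B + 1)))"
        using d(2) B by (intro mult_strict_left_mono) (auto simp: dist_norm norm_minus_commute)
      also have "\<dots> = e / 3"
        using B by (simp add: field_simps)
      finally show ?thesis .
    qed
    have "Cauchy (\<lambda>k. blinfun_apply (f k) d)"
      using conv[OF d(1)] by (rule convergent_Cauchy)
    then obtain N where N: "\<And>m n. m \<ge> N \<Longrightarrow> n \<ge> N \<Longrightarrow>
        \<bar>blinfun_apply (f m) d - blinfun_apply (f n) d\<bar> < e / 3"
      using \<open>e > 0\<close> unfolding Cauchy_def dist_real_def
      by (metis divide_pos_pos zero_less_numeral)
    show "\<exists>N. \<forall>m\<ge>N. \<forall>n\<ge>N. dist (blinfun_apply (f m) y) (blinfun_apply (f n) y) < e"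
    proof (intro exI allI impI)
      fix m n assume "m \<ge> N" "n \<ge> N"
      then show "dist (blinfun_apply (f m) y) (blinfun_apply (f n) y) < e"
        using near[of m] near[of n] N[of m n] unfolding dist_real_def by linarith
    qed
  qed
  then show ?thesis
    by (rule Cauchy_convergent)
qed

text \<open>
  Sequential Banach--Alaoglu theorem. Evaluation along a dense sequence maps the functionals into a countable
  product of compact intervals, which is compact and first countable, hence sequentially compact.
\<close>

lemma bounded_imp_weak_star_convergent_subsequence:
  fixes f :: "nat \<Rightarrow> ('y::real_normed_vector) dual"
  assumes sep: "separable_space (euclidean :: 'y topology)"
    and bound: "\<And>k. norm (f k) \<le> B"
  obtains l s where "strict_mono (s :: nat \<Rightarrow> nat)" "weak_star_tendsto (f \<circ> s) l"
proof -
  obtain D :: "'y set" where D: "countable D" "closure D = UNIV"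
    using sep by (auto simp: separable_space_def)
  then have "D \<noteq> {}"
    by auto
  define d where "d = from_nat_into D"
  have range_d: "range d = D"
    using D(1) \<open>D \<noteq> {}\<close> by (simp add: d_def range_from_nat_into)
  define K where "K = Pi\<^sub>E (UNIV :: nat set) (\<lambda>n. {- (B * norm (d n)) .. B * norm (d n)})"
  have "compactin (product_topology (\<lambda>_. euclidean) UNIV) K"
    unfolding K_def by (simp add: compactin_PiE)
  then have "compact K"
    by (simp add: euclidean_product_topology)
  then have seq: "seq_compact K"
    by (rule compact_imp_seq_compact)
  have mem: "(\<lambda>n. blinfun_apply (f k) (d n)) \<in> K" for k
  proof -
    have "\<bar>blinfun_apply (f k) (d n)\<bar> \<le> B * norm (d n)" for n
      using norm_blinfun[of "f k" "d n"] mult_right_mono[OF bound[of k] norm_ge_zero, of "d n"]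
      unfolding real_norm_def by (rule order_trans)
    from abs_le_D1[OF this] abs_le_D2[OF this]
    have "blinfun_apply (f k) (d n) \<in> {- (B * norm (d n)) .. B * norm (d n)}" for n
      unfolding atLeastAtMost_iff by (metis minus_le_iff)
    then show ?thesis
      unfolding K_def PiE_UNIV_domain by (rule Pi_I)
  qed
  obtain u s where s: "strict_mono (s :: nat \<Rightarrow> nat)"
    and u: "((\<lambda>k n. blinfun_apply (f k) (d n)) \<circ> s) \<longlonglongrightarrow> u"
    by (rule seq_compactE[OF seq allI[OF mem]])
  have "(\<lambda>k. blinfun_apply ((f \<circ> s) k) (d n)) \<longlonglongrightarrow> u n" for n
    using continuous_on_tendsto_compose[OF continuous_on_product_coordinates[of n] u]
    by (simp add: o_def)
  then have conv: "convergent (\<lambda>k. blinfun_apply ((f \<circ> s) k) y)" if "y \<in> D" for y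
    using that range_d by (auto simp: convergent_def)
  have bound_s: "norm ((f \<circ> s) k) \<le> B" for k
    by (simp add: bound)
  have "convergent (\<lambda>k. blinfun_apply ((f \<circ> s) k) y)" for y
    using bound_s D(2) conv by (rule bounded_convergent_on_dense_imp_convergent)
  then obtain l where "weak_star_tendsto (f \<circ> s) l"
    by (rule bounded_pointwise_convergent_imp_weak_star[OF bound_s])
  with s show thesis
    by (rule that)
qed

section \<open>Limits of feasible directions\<close>

lemma weak_star_tendsto_eventually_less:
  assumes lsc: "lower_semicontinuous_map weak_star_topology q"
    and h: "weak_star_tendsto h l"
    and a: "a < q l"
  shows "\<forall>\<^sub>F k in sequentially. a < q (h k)"
proof -
  have "openin weak_star_topology {x \<in> topspace weak_star_topology. a < q x}"
    using lsc by (simp add: lower_semicontinuous_map_def)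
  then have "\<forall>\<^sub>F k in sequentially. h k \<in> {x \<in> topspace weak_star_topology. a < q x}"
    using h a by (auto simp: weak_star_tendsto_def limitin_def strong_operator_topology_topspace)
  then show ?thesis
    by (auto elim: eventually_mono)
qed

lemma decreases_to_zero_subsequence:
  assumes "decreases_to_zero t" "strict_mono s"
  shows "decreases_to_zero (t \<circ> s)"
  using assms LIMSEQ_subseq_LIMSEQ[of t 0 s]
  by (auto simp: decreases_to_zero_def decseq_def strict_mono_less_eq)

lemma limit_in_weak_star_tangent_cone:
  assumes "decreases_to_zero t" "weak_star_tendsto h l" "\<And>k. x + t k *\<^sub>R h k \<in> C"
  shows "l \<in> weak_star_tangent_cone C x"
proof -
  have "(x + t k *\<^sub>R h k - x) /\<^sub>R t k = h k" for k
    using assms(1) by (simp add: decreases_to_zero_def less_imp_neq[THEN not_sym])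
  with assms show ?thesis
    unfolding weak_star_tangent_cone_def
    by (intro CollectI exI[of _ t] exI[of _ "\<lambda>k. x + t k *\<^sub>R h k"]) simp
qed

text \<open>
  The deviation of the feasible directions \<open>h k\<close> from their limit \<open>l\<close>, rescaled by \<open>2 / t k\<close>, is an
  admissible second-order correction of the ray in direction \<open>l\<close>; since \<open>\<phi> l = 0\<close>, the functional \<open>\<phi>\<close>
  takes the value \<open>2 * \<phi> (h k) / t k\<close> on it. Semicontinuity of \<open>q\<close> controls these values from above.
\<close>

lemma curvature_functional_le:
  fixes C :: "('y::real_normed_vector) dual set"
  assumes t: "decreases_to_zero t" and h: "weak_star_tendsto h l"
    and C: "\<And>k. x + t k *\<^sub>R h k \<in> C"
    and crit: "blinfun_apply \<phi> l = 0"
    and lsc: "lower_semicontinuous_map weak_star_topology q"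
    and le: "\<And>k. blinfun_apply \<phi> (h k) / t k + 1/2 * q (h k) \<le> e k"
    and e: "e \<longlonglongrightarrow> 0"
  shows "curvature_functional C x \<phi> l \<le> ereal (- q l)"
proof -
  define r where "r k = (2 / t k) *\<^sub>R (h k - l)" for k
  have t_pos: "t k > 0" for k
    using t by (simp add: decreases_to_zero_def)
  have tr: "t k *\<^sub>R r k = 2 *\<^sub>R (h k - l)" for k
    using t_pos[of k] by (simp add: r_def)
  have "x + t k *\<^sub>R l + ((1/2) * (t k)\<^sup>2) *\<^sub>R r k = x + t k *\<^sub>R h k" for k
  proof -
    have "((1/2) * (t k)\<^sup>2) *\<^sub>R r k = (t k / 2) *\<^sub>R (t k *\<^sub>R r k)"
      by (simp add: power2_eq_square)
    also have "\<dots> = t k *\<^sub>R (h k - l)"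
      unfolding tr by simp
    finally show ?thesis
      by (simp add: algebra_simps)
  qed
  then have feasible: "\<forall>k. x + t k *\<^sub>R l + ((1/2) * (t k)\<^sup>2) *\<^sub>R r k \<in> C"
    using C by (simp only: simp_thms)
  have "weak_star_tendsto (\<lambda>k. t k *\<^sub>R r k) 0"
    unfolding weak_star_tendsto_iff
  proof
    fix y
    have "(\<lambda>k. blinfun_apply (h k) y) \<longlonglongrightarrow> blinfun_apply l y"
      using h by (simp add: weak_star_tendsto_iff)
    then have "(\<lambda>k. 2 * (blinfun_apply (h k) y - blinfun_apply l y)) \<longlonglongrightarrow> 2 * 0"
      by (rule tendsto_mult_left[OF LIM_zero])
    then show "(\<lambda>k. blinfun_apply (t k *\<^sub>R r k) y) \<longlonglongrightarrow> blinfun_apply 0 y"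
      by (simp add: tr blinfun.scaleR_left blinfun.diff_left)
  qed
  then have "liminf (\<lambda>k. ereal (blinfun_apply \<phi> (r k))) \<in>
      {liminf (\<lambda>k. ereal (blinfun_apply \<phi> (r k))) | r t.
            decreases_to_zero t \<and> weak_star_tendsto (\<lambda>k. t k *\<^sub>R r k) 0 \<and>
            (\<forall>k. x + t k *\<^sub>R l + ((1/2) * (t k)\<^sup>2) *\<^sub>R r k \<in> C)}"
    using t feasible by (intro CollectI exI[of _ r] exI[of _ t]) simp
  then have "curvature_functional C x \<phi> l \<le> liminf (\<lambda>k. ereal (blinfun_apply \<phi> (r k)))"
    unfolding curvature_functional_def by (rule Inf_lower)
  moreover have "liminf (\<lambda>k. ereal (blinfun_apply \<phi> (r k))) \<le> ereal b" if b: "- q l < b" for b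
  proof -
    have phi_r: "blinfun_apply \<phi> (r k) = 2 * (blinfun_apply \<phi> (h k) / t k)" for k
      by (simp add: r_def blinfun.scaleR_right blinfun.diff_right crit)
    have "\<forall>\<^sub>F k in sequentially. - b < q (h k)"
      using lsc h b by (intro weak_star_tendsto_eventually_less) auto
    then have "\<forall>\<^sub>F k in sequentially. ereal (blinfun_apply \<phi> (r k)) \<le> ereal (2 * e k + b)"
    proof (rule eventually_mono)
      fix k assume "- b < q (h k)"
      then show "ereal (blinfun_apply \<phi> (r k)) \<le> ereal (2 * e k + b)"
        using le[of k] unfolding phi_r by simp
    qed
    then have "liminf (\<lambda>k. ereal (blinfun_apply \<phi> (r k))) \<le> liminf (\<lambda>k. ereal (2 * e k + b))"
      by (rule Liminf_mono)
    also have "(\<lambda>k. ereal (2 * e k + b)) \<longlonglongrightarrow> ereal (2 * 0 + b)"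
      using e by (intro tendsto_intros)
    then have "liminf (\<lambda>k. ereal (2 * e k + b)) = ereal b"
      by (simp add: lim_imp_Liminf)
    finally show ?thesis .
  qed
  then have "liminf (\<lambda>k. ereal (blinfun_apply \<phi> (r k))) \<le> ereal (- q l) + ereal \<epsilon>" if "\<epsilon> > 0" for \<epsilon>
    using that by simp
  then have "liminf (\<lambda>k. ereal (blinfun_apply \<phi> (r k))) \<le> ereal (- q l)"
    by (rule ereal_le_epsilon2)
  ultimately show ?thesis
    by (rule order_trans)
qed

section \<open>Quadratic growth\<close>

text \<open>
  The violating points are chosen one after the other, so that their distances to \<open>x\<close> decrease
  monotonically; this makes them a step size sequence.
\<close>

lemma no_quadratic_growth_imp_sequence:
  fixes C :: "'a::real_normed_vector set" and J :: "'a \<Rightarrow> real"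
  assumes fail: "\<not> (\<exists>c>0. \<exists>\<epsilon>>0. \<forall>z \<in> C \<inter> cball x \<epsilon>. J z \<ge> J x + (c/2) * (norm (z - x))\<^sup>2)"
  obtains t h where "decreases_to_zero t" "\<And>k. norm (h k) = 1" "\<And>k. x + t k *\<^sub>R h k \<in> C"
    "\<And>k. J (x + t k *\<^sub>R h k) \<le> J x + inverse (real (Suc k)) * (t k)\<^sup>2"
proof -
  define P where "P n z \<longleftrightarrow> z \<in> C \<and> z \<noteq> x \<and> norm (z - x) \<le> inverse (real (Suc n)) \<and>
      J z \<le> J x + inverse (real (Suc n)) * (norm (z - x))\<^sup>2" for n z
  have step: "\<exists>z. P n z \<and> norm (z - x) \<le> \<epsilon>" if "\<epsilon> > 0" for n \<epsilon>
  proof -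
    define c where "c = 2 * inverse (real (Suc n))"
    have "c > 0" "min \<epsilon> (inverse (real (Suc n))) > 0"
      using \<open>\<epsilon> > 0\<close> by (auto simp: c_def)
    with fail obtain z where z: "z \<in> C" "z \<in> cball x (min \<epsilon> (inverse (real (Suc n))))"
      "J z < J x + (c/2) * (norm (z - x))\<^sup>2"
      by (meson IntE not_le)
    then have "z \<noteq> x"
      by auto
    with z show ?thesis
      by (auto simp: P_def c_def dist_norm norm_minus_commute intro!: exI[of _ z])
  qed
  have "\<exists>z. \<forall>n. P n (z n) \<and> norm (z (Suc n) - x) \<le> norm (z n - x)"
  proof (rule dependent_nat_choice)
    show "\<exists>z. P 0 z"
      using step[of 1 0] by auto
    show "\<exists>w. P (Suc n) w \<and> norm (w - x) \<le> norm (z - x)" if "P n z" for z n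
      using that by (intro step) (simp add: P_def)
  qed
  then obtain z where z: "\<And>n. P n (z n)" "\<And>n. norm (z (Suc n) - x) \<le> norm (z n - x)"
    by blast
  define t where "t k = norm (z k - x)" for k
  define h where "h k = (z k - x) /\<^sub>R t k" for k
  have pos: "t k > 0" for k
    using z(1)[of k] by (simp add: P_def t_def)
  have point: "x + t k *\<^sub>R h k = z k" for k
    using pos[of k] by (simp add: h_def)
  have "t \<longlonglongrightarrow> 0"
  proof (rule tendsto_sandwich[OF _ _ tendsto_const LIMSEQ_inverse_real_of_nat])
    show "\<forall>\<^sub>F k in sequentially. 0 \<le> t k"
      by (simp add: t_def)
    show "\<forall>\<^sub>F k in sequentially. t k \<le> inverse (real (Suc k))"
      using z(1) by (simp add: t_def P_def)
  qed
  then have "decreases_to_zero t"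
    using pos z(2) by (simp add: decreases_to_zero_def decseq_Suc_iff t_def)
  moreover have "norm (h k) = 1" for k
    using pos[of k] by (simp add: h_def t_def)
  moreover have "x + t k *\<^sub>R h k \<in> C" for k
    using z(1) by (simp add: point P_def)
  moreover have "J (x + t k *\<^sub>R h k) \<le> J x + inverse (real (Suc k)) * (t k)\<^sup>2" for k
    using z(1)[of k] unfolding point by (simp add: P_def t_def)
  ultimately show thesis
    by (rule that)
qed

theorem theorem4p4:
  fixes C :: "('y::banach) dual set"
    and xbar :: "'y dual"
    and J :: "'y dual \<Rightarrow> real"
    and J' :: "'y dual dual"
    and J'' :: "'y dual \<Rightarrow> 'y dual \<Rightarrow> real"
  assumes "separable_space (euclidean :: 'y topology)"
    and "closed C" and "C \<noteq> {}" and "xbar \<in> C"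
    and "second_order_expansion C J xbar J' J''"
    and "lower_semicontinuous_map weak_star_topology (\<lambda>h. J'' h h)"
    and "J' \<in> uminus ` weak_star_normal_cone C xbar"
    and "\<forall>h \<in> critical_cone C xbar J' - {0}.
           curvature_functional C xbar J' h + ereal (J'' h h) > 0"
    and "nondegeneracy_condition C xbar J' J''"
  shows "\<exists>c>0. \<exists>\<epsilon>>0. \<forall>x \<in> C \<inter> cball xbar \<epsilon>.
           J x \<ge> J xbar + (c/2) * (norm (x - xbar))\<^sup>2"
proof (rule ccontr)
  assume "\<not> ?thesis"
  then obtain t0 h0 where t0: "decreases_to_zero t0" and h0: "\<And>k. norm (h0 k) = 1"
    and C0: "\<And>k. xbar + t0 k *\<^sub>R h0 k \<in> C"
    and J0: "\<And>k. J (xbar + t0 k *\<^sub>R h0 k) \<le> J xbar + inverse (real (Suc k)) * (t0 k)\<^sup>2"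
    by (rule no_quadratic_growth_imp_sequence) blast
  obtain l s where s: "strict_mono s" and lim: "weak_star_tendsto (h0 \<circ> s) l"
    using bounded_imp_weak_star_convergent_subsequence[OF assms(1), of h0 1] h0 by (metis order_refl)
  define t where "t = t0 \<circ> s"
  define h where "h = h0 \<circ> s"
  define \<delta> where "\<delta> k = inverse (real (Suc (s k)))" for k
  have t: "decreases_to_zero t"
    unfolding t_def using t0 s by (rule decreases_to_zero_subsequence)
  then have t_pos: "t k > 0" for k
    by (simp add: decreases_to_zero_def)
  have h: "weak_star_tendsto h l"
    using lim by (simp add: h_def)
  have norm_h: "norm (h k) = 1" for k
    by (simp add: h_def h0)
  have C: "xbar + t k *\<^sub>R h k \<in> C" for k
    by (simp add: h_def t_def C0)
  have J: "J (xbar + t k *\<^sub>R h k) \<le> J xbar + \<delta> k * (t k)\<^sup>2" for k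
    using J0[of "s k"] by (simp only: h_def t_def \<delta>_def o_apply)
  have "\<delta> \<longlonglongrightarrow> 0"
    unfolding \<delta>_def using LIMSEQ_subseq_LIMSEQ[OF LIMSEQ_inverse_real_of_nat s] by (simp add: o_def)

  \<comment> \<open>The remainder of the expansion, relative to the square of the step size.\<close>
  define \<rho> where "\<rho> k = (J (xbar + t k *\<^sub>R h k) - J xbar - t k * blinfun_apply J' (h k)
               - (1/2) * (t k)\<^sup>2 * J'' (h k) (h k)) / (t k)\<^sup>2" for k
  define e where "e k = \<delta> k - \<rho> k" for k
  have "\<rho> \<longlonglongrightarrow> 0"
    using assms(5) t h C unfolding second_order_expansion_def \<rho>_def by blast
  with \<open>\<delta> \<longlonglongrightarrow> 0\<close> have e: "e \<longlonglongrightarrow> 0"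
    unfolding e_def using tendsto_diff by fastforce
  have le: "blinfun_apply J' (h k) / t k + 1/2 * J'' (h k) (h k) \<le> e k" for k
  proof -
    have "\<rho> k + (blinfun_apply J' (h k) / t k + 1/2 * J'' (h k) (h k)) =
        (J (xbar + t k *\<^sub>R h k) - J xbar) / (t k)\<^sup>2"
      using t_pos[of k] by (simp add: \<rho>_def field_simps power2_eq_square)
    also have "\<dots> \<le> \<delta> k"
      using J[of k] t_pos[of k] by (simp add: pos_divide_le_eq)
    finally show ?thesis
      by (simp add: e_def)
  qed

  show False
  proof (cases "l = 0")
    case True
    then have "liminf (\<lambda>k. ereal (blinfun_apply J' (h k /\<^sub>R t k) + (1/2) * J'' (h k) (h k))) > 0"
      using assms(9) t h C norm_h unfolding nondegeneracy_condition_def by blast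
    moreover have "liminf (\<lambda>k. ereal (blinfun_apply J' (h k /\<^sub>R t k) + (1/2) * J'' (h k) (h k)))
        \<le> liminf (\<lambda>k. ereal (e k))"
    proof (intro Liminf_mono always_eventually allI)
      show "ereal (blinfun_apply J' (h k /\<^sub>R t k) + (1/2) * J'' (h k) (h k)) \<le> ereal (e k)" for k
        using le[of k] by (simp only: blinfun.scaleR_right real_scaleR_def divide_inverse_commute[symmetric] ereal_less_eq)
    qed
    moreover have "liminf (\<lambda>k. ereal (e k)) = 0"
      using e by (intro lim_imp_Liminf) (auto simp: zero_ereal_def)
    ultimately show False
      by simp
  next
    case False
    have tangent: "l \<in> weak_star_tangent_cone C xbar"
      using t h C by (rule limit_in_weak_star_tangent_cone)
    have "blinfun_apply J' l \<ge> 0"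
      using assms(7) tangent by (auto simp: weak_star_normal_cone_def blinfun.minus_left)
    moreover have "blinfun_apply J' l \<le> 0"
    proof -
      obtain y where y: "J' = canonical_embedding y"
        using assms(5) by (auto simp: second_order_expansion_def)
      have J'_lim: "(\<lambda>k. blinfun_apply J' (h k)) \<longlonglongrightarrow> blinfun_apply J' l"
        using h by (simp add: y weak_star_tendsto_iff)
      obtain M where M: "\<And>a b. norm (J'' a b) \<le> norm a * norm b * M"
        using assms(5) bounded_bilinear.bounded unfolding second_order_expansion_def by blast
      have "blinfun_apply J' (h k) \<le> t k * (e k + M / 2)" for k
      proof -
        have "\<bar>J'' (h k) (h k)\<bar> \<le> M"
          using M[of "h k" "h k"] by (simp add: norm_h)
        then have "blinfun_apply J' (h k) / t k \<le> e k + M / 2"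
          using le[of k] by linarith
        then show ?thesis
          using t_pos[of k] by (simp add: pos_divide_le_eq mult.commute)
      qed
      moreover have "(\<lambda>k. t k * (e k + M / 2)) \<longlonglongrightarrow> 0 * (0 + M / 2)"
        using t e by (intro tendsto_intros) (auto simp: decreases_to_zero_def)
      ultimately show ?thesis
        using J'_lim by (intro LIMSEQ_le[of _ _ "\<lambda>k. t k * (e k + M / 2)"]) auto
    qed
    ultimately have crit: "blinfun_apply J' l = 0"
      by simp
    then have "curvature_functional C xbar J' l + ereal (J'' l l) > 0"
      using assms(8) tangent False by (simp add: critical_cone_def)
    moreover have "curvature_functional C xbar J' l \<le> ereal (- J'' l l)"
      using t h C crit assms(6) le e by (rule curvature_functional_le)
    then have "curvature_functional C xbar J' l + ereal (J'' l l) \<le> ereal (- J'' l l) + ereal (J'' l l)"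
      by (rule add_right_mono)
    ultimately show False
      by (simp flip: zero_ereal_def)
  qed
qed

end
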